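(* Let $\varepsilon\ge0$ and let $\{z^t\}_{t\ge0}$ be the sequence generated by Stochastic Amplitude Flow, $z^{t+1}=z^t-\mu_t\,g_\varepsilon(z^t)$, with an arbitrary starting point $z^0\in\mathbb C^d$. Suppose the step sizes $\mu_t$ are positive and satisfy $$\sum_{t=0}^\infty\mu_t=\infty,\qquad\sum_{t=0}^\infty\mu_t^2<\infty,\qquad\beta\|A\|^2\mu_t\le1\ \text{ for all }t\ge0 .$$ Then $\mathbb E\,\mathcal L_\varepsilon(z^t)$ converges as $t\to\infty$, $c^2:=\sum_{t=0}^\infty\mathbb E\,\mu_t\|\nabla_z\mathcal L_\varepsilon(z^t)\|_2^2<\infty$, and, with $c\ge 0$, for all $T\ge1$ $$\min_{t=0,\dots,T-1}\mathbb E\|\nabla_z\mathcal L_\varepsilon(z^t)\|_2\le c\left[\sum_{t=0}^{T-1}\mu_t\right]^{-1/2},$$ so that $\min_{t=0,\dots,T-1}\mathbb E\|\nabla_z\mathcal L_\varepsilon(z^t)\|_2\to0$ as $T\to\infty$. If additionally $\{\mu_t\}_{t\ge 0}$ is decreasing and $\sum_{t=1}^\infty\frac{\mu_t}{\sum_{s=0}^{t-1}\mu_s}=\infty$, then $$\min_{t=0,\dots,T-1}\mathbb E\|\nabla_z\mathcal L_\varepsilon(z^t)\|_2=o\left(\left[\sum_{t=0}^{T-1}\mu_t\right]^{-1/2}\right)\quad\text{as }T\to\infty .$$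
   Context: Let $A\in\mathbb C^{m\times d}$ and $y\in[0,\infty)^m$ (phase retrieval measurements $y=|Ax|^2+n$ of an unknown $x\in\mathbb C^d$ with perturbation $n\in\mathbb R^m$). Functions such as $|\cdot|$, square, square root and addition of a constant act entrywise on vectors; $\circ$ and $/$ between vectors are entrywise product and division; $\operatorname{sgn}(a)=a/|a|$ for $a\ne0$ and $\operatorname{sgn}(0)=0$, applied entrywise. $\|\cdot\|$ is the spectral norm of a matrix. For $\varepsilon\ge0$ the loss is $\mathcal L_\varepsilon(z)=\|\sqrt{|Az|^2+\varepsilon}-\sqrt{y+\varepsilon}\|_2^2$, $z\in\mathbb C^d$. Its (generalized) Wirtinger gradient is $\nabla_z\mathcal L_\varepsilon(z)=A^*(Az-\sqrt{y+\varepsilon}\circ Az/\sqrt{|Az|^2+\varepsilon})$ for $\varepsilon>0$ and $\nabla_z\mathcal L_0(z)=A^*(Az-\sqrt y\circ\operatorname{sgn}(Az))$ for $\varepsilon=0$. Partition the rows of $A$ into $R$ blocks $A_1,\dots,A_R$ ($1\le R\le m$), with $y^1,\dots,y^R$ the corresponding blocks of $y$. Let $\mathcal L_{\varepsilon,r}(z)=\|\sqrt{|A_rz|^2+\varepsilon}-\sqrt{y^r+\varepsilon}\|_2^2$, so $\mathcal L_\varepsilon=\sum_{r=1}^R\mathcal L_{\varepsilon,r}$; $\nabla_z\mathcal L_{\varepsilon,r}$ is defined by the same formulas with $(A_r,y^r)$ in place of $(A,y)$. Let $p$ be a probability distribution on $\{1,\dots,R\}$ with $0<p_r<1$ for all $r$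 and $\sum_r p_r=1$, and let $K\in\mathbb N$, $K\ge1$. The stochastic gradient is $g_\varepsilon(z)=\frac1K\sum_{k=1}^K\frac{1}{p_{r_k}}\nabla_z\mathcal L_{\varepsilon,r_k}(z)$, where $r_1,\dots,r_K$ are drawn independently with replacement from $p$; in Stochastic Amplitude Flow fresh indices, independent of all previous ones, are drawn at every iteration $t$. The constant $\beta$ is $\beta=1-\frac1K$. For sequences, $a_T=o(b_T)$ as $T\to\infty$ means $a_T/b_T\to0$. *)

theory Defs
  imports "HOL-Probability.Probability" "HOL-Library.Landau_Symbols"
begin

definition conj_transpose :: "complex ^ 'd ^ 'm \<Rightarrow> complex ^ 'm ^ 'd" where
  "conj_transpose A = (\<chi> i j. cnj (A $ j $ i))"

text \<open>The norm on \<open>complex ^ 'n\<close> is the Euclidean one, so the operator norm below is the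
  largest singular value.\<close>

definition spectral_norm :: "complex ^ 'd::finite ^ 'm::finite \<Rightarrow> real" where
  "spectral_norm A = onorm (\<lambda>x. A *v x)"

definition amp_loss ::
    "complex ^ 'd::finite ^ 'm::finite \<Rightarrow> real ^ 'm \<Rightarrow> real \<Rightarrow> complex ^ 'd \<Rightarrow> real" where
  "amp_loss A y \<epsilon> z =
     (norm (\<chi> j. sqrt ((cmod ((A *v z) $ j))\<^sup>2 + \<epsilon>) - sqrt (y $ j + \<epsilon>)))\<^sup>2"

text \<open>Generalized Wirtinger gradient of the loss, meant for \<open>\<epsilon> \<ge> 0\<close>.\<close>

definition amp_grad ::
    "complex ^ 'd::finite ^ 'm::finite \<Rightarrow> real ^ 'm \<Rightarrow> real \<Rightarrow> complex ^ 'd \<Rightarrow> complex ^ 'd" where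
  "amp_grad A y \<epsilon> z =
     (if \<epsilon> = 0
      then conj_transpose A *v
        (\<chi> j. (A *v z) $ j - of_real (sqrt (y $ j)) * sgn ((A *v z) $ j))
      else conj_transpose A *v
        (\<chi> j. (A *v z) $ j - of_real (sqrt (y $ j + \<epsilon>)) * (A *v z) $ j
                 / of_real (sqrt ((cmod ((A *v z) $ j))\<^sup>2 + \<epsilon>))))"

text \<open>
  A block of rows of a matrix (a vector of rows), or of entries of a vector, is identified by its
  set \<open>S\<close> of indices.  As the number of rows is part of the type, the rows outside \<open>S\<close> are set to
  zero instead of being deleted.  Zeroing both the matrix and the data leaves exactly the
  contribution of the rows in \<open>S\<close> to the loss and to its gradient, see \<open>amp_loss_block\<close> and
  \<open>amp_grad_block\<close>.
\<close>

definition block :: "'m set \<Rightarrow> 'a::zero ^ 'm \<Rightarrow> 'a ^ 'm" where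
  "block S v = (\<chi> j. if j \<in> S then v $ j else 0)"

lemma block_mult_vec: "(block S A *v z) $ j = (if j \<in> S then (A *v z) $ j else 0)"
  for A :: "complex ^ 'd::finite ^ 'm::finite"
  by (simp add: block_def matrix_vector_mult_def)

lemma amp_loss_block:
  fixes A :: "complex ^ 'd::finite ^ 'm::finite"
  shows "amp_loss (block S A) (block S y) \<epsilon> z =
    (\<Sum>j\<in>S. (sqrt ((cmod ((A *v z) $ j))\<^sup>2 + \<epsilon>) - sqrt (y $ j + \<epsilon>))\<^sup>2)"
proof -
  have "amp_loss (block S A) (block S y) \<epsilon> z =
    (\<Sum>j\<in>UNIV. if j \<in> S then
       (sqrt ((cmod ((A *v z) $ j))\<^sup>2 + \<epsilon>) - sqrt (y $ j + \<epsilon>))\<^sup>2 else 0)"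
    unfolding amp_loss_def norm_vec_def L2_set_def
    by (auto simp: block_mult_vec sum_nonneg intro!: sum.cong) (auto simp: block_def)
  then show ?thesis
    by (simp add: sum.If_cases)
qed

lemma amp_grad_block:
  fixes A :: "complex ^ 'd::finite ^ 'm::finite"
  shows "amp_grad (block S A) (block S y) \<epsilon> z $ i =
    (\<Sum>j\<in>S. cnj (A $ j $ i) * ((A *v z) $ j -
       (if \<epsilon> = 0 then of_real (sqrt (y $ j)) * sgn ((A *v z) $ j)
        else of_real (sqrt (y $ j + \<epsilon>)) * (A *v z) $ j
               / of_real (sqrt ((cmod ((A *v z) $ j))\<^sup>2 + \<epsilon>)))))"
proof -
  have adj: "(conj_transpose (block S A) *v w) $ i = (\<Sum>j\<in>S. cnj (A $ j $ i) * w $ j)"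
    for w :: "complex ^ 'm"
  proof -
    have "(conj_transpose (block S A) *v w) $ i =
      (\<Sum>j\<in>UNIV. if j \<in> S then cnj (A $ j $ i) * w $ j else 0)"
      unfolding matrix_vector_mult_def by (auto simp: conj_transpose_def block_def intro!: sum.cong)
    then show ?thesis
      by (simp add: sum.If_cases)
  qed
  show ?thesis
    unfolding amp_grad_def by (auto simp: adj block_mult_vec block_def[of S y] intro!: sum.cong)
qed

text \<open>
  The stochastic gradient for the drawn block indices \<open>i 1, \<dots>, i K\<close>, where \<open>B r\<close> is the set of
  rows in the \<open>r\<close>-th block and \<open>p\<close> the sampling distribution.
\<close>

definition stoch_grad ::
    "complex ^ 'd::finite ^ 'm::finite \<Rightarrow> real ^ 'm \<Rightarrow> real \<Rightarrow> (nat \<Rightarrow> 'm set) \<Rightarrow> nat pmf \<Rightarrow> nat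
      \<Rightarrow> (nat \<Rightarrow> nat) \<Rightarrow> complex ^ 'd \<Rightarrow> complex ^ 'd" where
  "stoch_grad A y \<epsilon> B p K i z =
     (1 / real K) *\<^sub>R (\<Sum>k=1..K. (1 / pmf p (i k)) *\<^sub>R
        amp_grad (block (B (i k)) A) (block (B (i k)) y) \<epsilon> z)"

end

theory Submission
  imports Defs
begin

text \<open>
  The loss is majorized by its linearization plus \<open>\<parallel>A h\<parallel>\<^sup>2\<close> (\<open>amp_loss_majorization\<close>), since
  \<open>sqrt (\<bar>u\<bar>\<^sup>2 + \<epsilon>)\<close> is convex.  For a fixed point \<open>x\<close>, averaging this bound over the \<open>K\<close> independent draws
  uses that the stochastic gradient is unbiased and that the second moment of a sample mean is
  \<open>1 - 1 / K\<close> times the squared mean plus \<open>1 / K\<close> times the second moment of one sample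
  (\<open>expectation_square_sample_mean\<close>).  The second moment of one sample is at most a constant \<open>V\<close> times
  the loss, because every block gradient is controlled by its block loss.  With
  \<open>(1 - 1 / K) \<parallel>A\<parallel>\<^sup>2 \<mu>\<^sub>t \<le> 1\<close> this gives (\<open>expected_loss_step\<close>)

    \<open>E \<L>(x - \<mu>\<^sub>t g(x)) \<le> (1 + V \<mu>\<^sub>t\<^sup>2) \<L>(x) - \<mu>\<^sub>t \<parallel>\<nabla>\<L>(x)\<parallel>\<^sup>2\<close>.

  The iterate at time \<open>t\<close> is a function of earlier draws and takes finitely many values, so it may
  be substituted for \<open>x\<close> (\<open>expectation_freeze\<close>), which gives the same recursion for the expected
  losses (\<open>expected_loss_recursion\<close>).  As the squares of the step sizes are summable, a deterministic
  Robbins--Siegmund argument (\<open>robbins_siegmund_deterministic\<close>) shows that the expected losses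
  converge and that \<open>\<mu>\<^sub>t E \<parallel>\<nabla>\<L>(z\<^sub>t)\<parallel>\<^sup>2\<close> is summable.

  Since \<open>(E \<parallel>\<nabla>\<L>\<parallel>)\<^sup>2 \<le> E \<parallel>\<nabla>\<L>\<parallel>\<^sup>2\<close>, the rates concern only a sequence \<open>b\<close> with \<open>\<Sum>\<mu>\<^sub>t b\<^sub>t\<^sup>2 < \<infinity>\<close>.  A minimum is
  at most a weighted mean, which is the rate with the constant \<open>c\<close> (\<open>min_rate\<close>).  Taking the weighted
  mean over a late window instead replaces \<open>c\<^sup>2\<close> by a tail of the series, while the weight of the
  window is still at least half of the total, and this improves the rate to little-o
  (\<open>min_rate_smallo\<close>).
\<close>

section \<open>Quadratic majorization of the amplitude loss\<close>

text \<open>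
  One entry of the vector to which \<open>A\<^sup>*\<close> is applied in the gradient.  For \<open>\<epsilon> = 0\<close> the quotient
  \<open>u / \<bar>u\<bar>\<close> is \<open>sgn u\<close>, including at \<open>u = 0\<close> because division by zero gives zero, so that one formula
  covers both branches of the generalized Wirtinger gradient.
\<close>

definition amp_residual :: "real \<Rightarrow> real \<Rightarrow> complex \<Rightarrow> complex" where
  "amp_residual \<epsilon> b u = u - of_real b * u / of_real (sqrt ((cmod u)\<^sup>2 + \<epsilon>))"

text \<open>
  In \<open>(sqrt (\<bar>u\<bar>\<^sup>2 + \<epsilon>) - b)\<^sup>2 = \<bar>u\<bar>\<^sup>2 + \<epsilon> - 2 * b * sqrt (\<bar>u\<bar>\<^sup>2 + \<epsilon>) + b\<^sup>2\<close> the first term is quadratic and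
  expands exactly.  The middle term is concave, since \<open>sqrt (\<bar>u\<bar>\<^sup>2 + \<epsilon>)\<close> is the norm of the pair
  \<open>(u, sqrt \<epsilon>)\<close>, hence it lies below its tangent; where this norm vanishes, zero serves as a
  subgradient.
\<close>

lemma amp_residual_majorization:
  fixes u v :: complex
  assumes "0 \<le> \<epsilon>" "0 \<le> b"
  shows "(sqrt ((cmod (u + v))\<^sup>2 + \<epsilon>) - b)\<^sup>2
    \<le> (sqrt ((cmod u)\<^sup>2 + \<epsilon>) - b)\<^sup>2 + 2 * (amp_residual \<epsilon> b u \<bullet> v) + (cmod v)\<^sup>2"
proof -
  define s where "s = sqrt ((cmod u)\<^sup>2 + \<epsilon>)"
  define s' where "s' = sqrt ((cmod (u + v))\<^sup>2 + \<epsilon>)"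
  have sq: "s\<^sup>2 = (cmod u)\<^sup>2 + \<epsilon>" "s'\<^sup>2 = (cmod (u + v))\<^sup>2 + \<epsilon>"
    unfolding s_def s'_def using assms by auto
  have nonneg: "0 \<le> s" "0 \<le> s'"
    unfolding s_def s'_def using assms by auto
  have expand: "(cmod (u + v))\<^sup>2 = (cmod u)\<^sup>2 + 2 * (u \<bullet> v) + (cmod v)\<^sup>2"
    by (simp add: power2_norm_eq_inner inner_add_left inner_add_right inner_commute)
  have res: "amp_residual \<epsilon> b u \<bullet> v = u \<bullet> v - b * ((u \<bullet> v) / s)"
  proof -
    have "amp_residual \<epsilon> b u = u - (b / s) *\<^sub>R u"
      by (simp add: amp_residual_def s_def scaleR_conv_of_real)
    then show ?thesis
      by (simp add: inner_diff_left)
  qed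
  \<comment> \<open>The tangent inequality is Cauchy--Schwarz for the pairs \<open>(u, sqrt \<epsilon>)\<close> and \<open>(u + v, sqrt \<epsilon>)\<close>.\<close>
  have tangent: "s + (u \<bullet> v) / s \<le> s'"
  proof (cases "s = 0")
    case True
    then show ?thesis using nonneg by simp
  next
    case False
    have "(u, sqrt \<epsilon>) \<bullet> (u + v, sqrt \<epsilon>) \<le> norm (u, sqrt \<epsilon>) * norm (u + v, sqrt \<epsilon>)"
      by (rule norm_cauchy_schwarz)
    then have "s\<^sup>2 + u \<bullet> v \<le> s * s'"
      using assms sq(1)
      by (simp add: norm_Pair s_def s'_def inner_add_right power2_norm_eq_inner)
    then show ?thesis
      using False nonneg by (simp add: field_simps power2_eq_square)
  qed
  have "b * (s + (u \<bullet> v) / s) \<le> b * s'"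
    using tangent assms(2) by (rule mult_left_mono)
  then show ?thesis
    using sq expand res
    unfolding s_def[symmetric] s'_def[symmetric] by (simp add: power2_diff algebra_simps)
qed

text \<open>
  With \<open>s = sqrt (\<bar>u\<bar>\<^sup>2 + \<epsilon>)\<close> the residual is \<open>(s - b) * u / s\<close>, and \<open>\<bar>u\<bar> \<le> s\<close>.
\<close>

lemma cmod_amp_residual_le:
  assumes "0 \<le> \<epsilon>"
  shows "cmod (amp_residual \<epsilon> b u) \<le> \<bar>sqrt ((cmod u)\<^sup>2 + \<epsilon>) - b\<bar>"
proof (cases "u = 0")
  case False
  define s where "s = sqrt ((cmod u)\<^sup>2 + \<epsilon>)"
  have "0 < s" and le: "cmod u \<le> s"
    using False assms by (auto simp: s_def add_pos_nonneg intro!: real_le_rsqrt)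
  have "amp_residual \<epsilon> b u = ((s - b) / s) *\<^sub>R u"
    unfolding amp_residual_def s_def[symmetric]
    using \<open>0 < s\<close> by (simp add: scaleR_conv_of_real field_simps)
  then have "cmod (amp_residual \<epsilon> b u) = \<bar>s - b\<bar> * (cmod u / s)"
    using \<open>0 < s\<close> by simp
  also have "\<dots> \<le> \<bar>s - b\<bar> * 1"
    using le \<open>0 < s\<close> by (intro mult_left_mono) auto
  finally show ?thesis by (simp add: s_def)
qed (simp add: amp_residual_def)

lemma amp_loss_eq_sum:
  "amp_loss A y \<epsilon> z = (\<Sum>j\<in>UNIV. (sqrt ((cmod ((A *v z) $ j))\<^sup>2 + \<epsilon>) - sqrt (y $ j + \<epsilon>))\<^sup>2)"
  by (simp add: amp_loss_def norm_vec_def L2_set_def sum_nonneg)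

lemma amp_loss_nonneg: "0 \<le> amp_loss A y \<epsilon> z"
  by (simp add: amp_loss_def)

lemma amp_grad_eq_residual:
  "amp_grad A y \<epsilon> z =
    conj_transpose A *v (\<chi> j. amp_residual \<epsilon> (sqrt (y $ j + \<epsilon>)) ((A *v z) $ j))"
proof (cases "\<epsilon> = 0")
  case True
  have "sgn u = u / of_real (cmod u)" for u :: complex
    by (simp add: sgn_eq)
  with True show ?thesis
    by (simp add: amp_grad_def amp_residual_def)
qed (simp add: amp_grad_def amp_residual_def)

lemma conj_transpose_adjoint:
  fixes A :: "complex ^ 'd::finite ^ 'm::finite"
  shows "(conj_transpose A *v w) \<bullet> h = w \<bullet> (A *v h)"
proof -
  have inner: "(cnj a * x) \<bullet> b = x \<bullet> (a * b)" for a x b :: complex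
    by (simp add: inner_complex_def algebra_simps)
  have "(conj_transpose A *v w) \<bullet> h = (\<Sum>i\<in>UNIV. \<Sum>j\<in>UNIV. w $ j \<bullet> (A $ j $ i * h $ i))"
    by (simp add: inner_vec_def matrix_vector_mult_def conj_transpose_def inner_sum_left inner)
  also have "\<dots> = (\<Sum>j\<in>UNIV. \<Sum>i\<in>UNIV. w $ j \<bullet> (A $ j $ i * h $ i))"
    by (rule sum.swap)
  also have "\<dots> = w \<bullet> (A *v h)"
    by (simp add: inner_vec_def matrix_vector_mult_def inner_sum_right)
  finally show ?thesis .
qed

lemma spectral_norm_nonneg: "0 \<le> spectral_norm A"
  unfolding spectral_norm_def by (intro onorm_pos_le matrix_vector_mul_bounded_linear)

lemma norm_mult_vec_le: "norm (A *v x) \<le> spectral_norm A * norm x"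
  unfolding spectral_norm_def by (intro onorm matrix_vector_mul_bounded_linear)

text \<open>
  Test the adjoint relation with \<open>h = A\<^sup>* w\<close> and cancel one factor \<open>\<parallel>A\<^sup>* w\<parallel>\<close>.
\<close>

lemma norm_conj_transpose_mult_vec_le: "norm (conj_transpose A *v w) \<le> spectral_norm A * norm w"
proof (cases "conj_transpose A *v w = 0")
  case True
  then show ?thesis by (simp add: spectral_norm_nonneg)
next
  case False
  define g where "g = conj_transpose A *v w"
  have "(norm g)\<^sup>2 = w \<bullet> (A *v g)"
    unfolding power2_norm_eq_inner by (simp add: g_def conj_transpose_adjoint)
  also have "\<dots> \<le> norm w * norm (A *v g)"
    by (rule norm_cauchy_schwarz)
  also have "\<dots> \<le> norm w * (spectral_norm A * norm g)"
    by (intro mult_left_mono norm_mult_vec_le) simp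
  finally have "norm g * norm g \<le> (spectral_norm A * norm w) * norm g"
    by (simp add: power2_eq_square mult_ac)
  then show ?thesis
    using False by (simp add: g_def)
qed

text \<open>
  The quadratic term is \<open>\<parallel>A h\<parallel>\<^sup>2\<close> with constant one.  Keeping \<open>A h\<close> instead of bounding it by
  \<open>\<parallel>A\<parallel> \<parallel>h\<parallel>\<close> makes the step size condition come out with the factor \<open>1 - 1 / K\<close>: the mean of \<open>A g\<close>
  and its variance can then be treated separately.
\<close>

lemma amp_loss_majorization:
  fixes A :: "complex ^ 'd::finite ^ 'm::finite"
  assumes "\<And>j. 0 \<le> y $ j" "0 \<le> \<epsilon>"
  shows "amp_loss A y \<epsilon> (z + h)
    \<le> amp_loss A y \<epsilon> z + 2 * (amp_grad A y \<epsilon> z \<bullet> h) + (norm (A *v h))\<^sup>2"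
proof -
  define r where "r = (\<chi> j. amp_residual \<epsilon> (sqrt (y $ j + \<epsilon>)) ((A *v z) $ j))"
  have "amp_loss A y \<epsilon> (z + h) \<le> (\<Sum>j\<in>UNIV.
     (sqrt ((cmod ((A *v z) $ j))\<^sup>2 + \<epsilon>) - sqrt (y $ j + \<epsilon>))\<^sup>2
       + 2 * (r $ j \<bullet> (A *v h) $ j) + (cmod ((A *v h) $ j))\<^sup>2)"
    unfolding amp_loss_eq_sum matrix_vector_right_distrib r_def
    using assms by (auto intro!: sum_mono amp_residual_majorization add_nonneg_nonneg)
  also have "\<dots> = amp_loss A y \<epsilon> z + 2 * (r \<bullet> (A *v h)) + (norm (A *v h))\<^sup>2"
    by (simp add: sum.distrib amp_loss_eq_sum inner_vec_def sum_distrib_left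
        power2_norm_eq_inner)
  also have "r \<bullet> (A *v h) = amp_grad A y \<epsilon> z \<bullet> h"
    by (simp add: amp_grad_eq_residual r_def conj_transpose_adjoint)
  finally show ?thesis .
qed

text \<open>
  The residual is entrywise at most the amplitude error.  Applied to a single block, this controls the
  variance of the stochastic gradient by the loss itself, however far the iterates move.
\<close>

lemma amp_grad_norm_le_loss:
  assumes "0 \<le> \<epsilon>"
  shows "(norm (amp_grad A y \<epsilon> z))\<^sup>2 \<le> (spectral_norm A)\<^sup>2 * amp_loss A y \<epsilon> z"
proof -
  define r where "r = (\<chi> j. amp_residual \<epsilon> (sqrt (y $ j + \<epsilon>)) ((A *v z) $ j))"
  have "(norm (amp_grad A y \<epsilon> z))\<^sup>2 \<le> (spectral_norm A * norm r)\<^sup>2"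
    unfolding amp_grad_eq_residual r_def[symmetric]
    by (intro power_mono norm_conj_transpose_mult_vec_le) simp
  also have "\<dots> = (spectral_norm A)\<^sup>2 * (norm r)\<^sup>2"
    by (rule power_mult_distrib)
  also have "(norm r)\<^sup>2 = (\<Sum>j\<in>UNIV. (cmod (r $ j))\<^sup>2)"
    by (simp add: norm_vec_def L2_set_def sum_nonneg)
  also have "\<dots> \<le> amp_loss A y \<epsilon> z"
    unfolding amp_loss_eq_sum r_def
    using power_mono[OF cmod_amp_residual_le[OF assms], of _ _ 2] by (auto intro!: sum_mono)
  finally show ?thesis
    by (simp add: mult_left_mono)
qed

lemma amp_loss_blocks:
  fixes A :: "complex ^ 'd::finite ^ 'm::finite"
  assumes "finite I" "disjoint_family_on B I" "(\<Union>r\<in>I. B r) = UNIV"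
  shows "(\<Sum>r\<in>I. amp_loss (block (B r) A) (block (B r) y) \<epsilon> z) = amp_loss A y \<epsilon> z"
  unfolding amp_loss_block amp_loss_eq_sum[of A] assms(3)[symmetric]
  using assms by (subst sum.UNION_disjoint) (auto simp: disjoint_family_on_def)

lemma amp_grad_blocks:
  fixes A :: "complex ^ 'd::finite ^ 'm::finite"
  assumes "finite I" "disjoint_family_on B I" "(\<Union>r\<in>I. B r) = UNIV"
  shows "(\<Sum>r\<in>I. amp_grad (block (B r) A) (block (B r) y) \<epsilon> z) = amp_grad A y \<epsilon> z"
proof -
  have whole: "block (\<Union>r\<in>I. B r) A = A" "block (\<Union>r\<in>I. B r) y = y"
    by (simp_all add: block_def vec_eq_iff assms(3))
  have "(\<Sum>r\<in>I. amp_grad (block (B r) A) (block (B r) y) \<epsilon> z)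
      = amp_grad (block (\<Union>r\<in>I. B r) A) (block (\<Union>r\<in>I. B r) y) \<epsilon> z"
    unfolding vec_eq_iff sum_component amp_grad_block
    using assms(1,2) by (subst sum.UNION_disjoint) (auto simp: disjoint_family_on_def)
  then show ?thesis
    by (simp only: whole)
qed

section \<open>Recursive inequalities and best-iterate rates\<close>

text \<open>
  Dividing \<open>a t\<close> by the partial products \<open>P t\<close> of the factors \<open>1 + c s\<close> turns the recursion into a
  decreasing one whose decrements dominate \<open>b t / P (Suc t)\<close>.  The products increase and stay below
  \<open>exp (\<Sum>s. c s)\<close>, so both conclusions carry over to \<open>a\<close> and \<open>b\<close>.
\<close>

lemma robbins_siegmund_deterministic:
  fixes a b c :: "nat \<Rightarrow> real"
  assumes nonneg: "\<And>t. 0 \<le> a t" "\<And>t. 0 \<le> b t" "\<And>t. 0 \<le> c t"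
    and step: "\<And>t. a (Suc t) \<le> (1 + c t) * a t - b t"
    and c: "summable c"
  shows "convergent a" "summable b"
proof -
  define P where "P t = (\<Prod>s<t. 1 + c s)" for t
  define D where "D = exp (suminf c)"
  have P_ge: "1 \<le> P t" for t
    unfolding P_def using nonneg by (intro prod_ge_1) simp
  have P_pos: "0 < P t" for t
    using P_ge[of t] by simp
  have P_Suc: "P (Suc t) = (1 + c t) * P t" for t
    by (simp add: P_def)
  have P_le: "P t \<le> D" for t
  proof -
    have "P t \<le> (\<Prod>s<t. exp (c s))"
      unfolding P_def using nonneg by (intro prod_mono) (auto simp: add_nonneg_nonneg)
    also have "\<dots> = exp (\<Sum>s<t. c s)"
      by (simp add: exp_sum)
    also have "\<dots> \<le> D"
      unfolding D_def using c nonneg by (simp add: sum_le_suminf)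
    finally show ?thesis .
  qed
  have "incseq P"
    using nonneg P_pos by (intro incseq_SucI) (simp add: P_Suc algebra_simps less_imp_le)
  then have "\<exists>p. P \<longlonglongrightarrow> p"
    using incseq_convergent[of P D] P_le by metis
  then obtain p where p: "P \<longlonglongrightarrow> p" ..
  define q where "q t = a t / P t" for t
  have q_step: "q (Suc t) + b t / P (Suc t) \<le> q t" for t
  proof -
    have "q (Suc t) + b t / P (Suc t) = (a (Suc t) + b t) / P (Suc t)"
      by (simp add: q_def add_divide_distrib)
    also have "\<dots> \<le> ((1 + c t) * a t) / P (Suc t)"
      using step[of t] P_pos[of "Suc t"] by (intro divide_right_mono) auto
    also have "\<dots> = q t"
      using nonneg(3)[of t] by (simp add: q_def P_Suc)
    finally show ?thesis .
  qed
  have q_nonneg: "0 \<le> q t" for t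
    using nonneg P_pos[of t] by (simp add: q_def)
  have quot_nonneg: "0 \<le> b t / P (Suc t)" for t
    using nonneg P_pos[of "Suc t"] by simp
  have "decseq q"
  proof (rule decseq_SucI)
    show "q (Suc t) \<le> q t" for t
      using q_step[of t] quot_nonneg[of t] by linarith
  qed
  then have "\<exists>l. q \<longlonglongrightarrow> l"
    using decseq_convergent[of q 0] q_nonneg by metis
  then obtain l where l: "q \<longlonglongrightarrow> l" ..
  have "(\<lambda>t. q t * P t) \<longlonglongrightarrow> l * p"
    by (intro tendsto_mult l p)
  moreover have "q t * P t = a t" for t
    using P_pos[of t] by (simp add: q_def)
  ultimately show "convergent a"
    by (auto simp: convergent_def)
  have partial: "(\<Sum>s<t. b s / P (Suc s)) \<le> q 0 - q t" for t
  proof (induction t)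
    case (Suc t)
    then show ?case using q_step[of t] by simp
  qed simp
  have "summable (\<lambda>t. b t / P (Suc t))"
  proof (rule summableI_nonneg_bounded)
    show "(\<Sum>s<t. b s / P (Suc s)) \<le> q 0" for t
      using partial[of t] q_nonneg[of t] by linarith
  qed (rule quot_nonneg)
  then have "summable (\<lambda>t. D * (b t / P (Suc t)))"
    by (rule summable_mult)
  then show "summable b"
  proof (rule summable_comparison_test'[where N = 0])
    show "norm (b t) \<le> D * (b t / P (Suc t))" for t
      using mult_right_mono[OF P_le[of "Suc t"] quot_nonneg[of t]] nonneg(2)[of t] P_pos[of "Suc t"]
      by simp
  qed
qed

text \<open>
  The sums start at an arbitrary \<open>N\<close> although the minimum is over all of \<open>{..<T}\<close>: with \<open>N = 0\<close> this
  is the rate with a constant, and with \<open>N\<close> large the right-hand side is a small tail.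
\<close>

lemma weighted_min_square_le:
  fixes \<mu> b :: "nat \<Rightarrow> real"
  assumes "\<And>t. 0 \<le> b t" "\<And>t. 0 \<le> \<mu> t" "N \<le> T" "1 \<le> T"
  shows "(MIN t\<in>{..<T}. b t)\<^sup>2 * (\<Sum>t=N..<T. \<mu> t) \<le> (\<Sum>t=N..<T. \<mu> t * (b t)\<^sup>2)"
proof -
  have "{..<T} \<noteq> {}" using assms(4) by (auto simp: lessThan_empty_iff)
  then have "0 \<le> (MIN t\<in>{..<T}. b t)" and "t \<in> {N..<T} \<Longrightarrow> (MIN t\<in>{..<T}. b t) \<le> b t" for t
    using assms(1) by auto
  then have "(MIN t\<in>{..<T}. b t)\<^sup>2 * \<mu> t \<le> \<mu> t * (b t)\<^sup>2" if "t \<in> {N..<T}" for t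
    using that assms(2)[of t] power_mono[of "MIN t\<in>{..<T}. b t" "b t" 2]
    by (simp add: mult.commute mult_left_mono)
  then show ?thesis
    unfolding sum_distrib_left by (rule sum_mono)
qed

lemma min_rate:
  fixes \<mu> b :: "nat \<Rightarrow> real"
  assumes b: "\<And>t. 0 \<le> b t" and \<mu>: "\<And>t. 0 < \<mu> t" and T: "1 \<le> T" and c: "0 \<le> c"
    and le: "(\<Sum>t<T. \<mu> t * (b t)\<^sup>2) \<le> c\<^sup>2"
  shows "(MIN t\<in>{..<T}. b t) \<le> c * (\<Sum>t<T. \<mu> t) powr (- 1 / 2)"
proof -
  define S where "S = (\<Sum>t<T. \<mu> t)"
  have "0 < S"
    unfolding S_def using T \<mu> by (intro sum_pos) (auto simp: lessThan_empty_iff)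
  have "(MIN t\<in>{..<T}. b t)\<^sup>2 * S \<le> c\<^sup>2"
    using weighted_min_square_le[of b \<mu> 0 T] b \<mu> T le
    by (auto simp: S_def atLeast0LessThan less_imp_le intro: order_trans)
  then have "(MIN t\<in>{..<T}. b t)\<^sup>2 \<le> c\<^sup>2 / S"
    using \<open>0 < S\<close> by (simp add: field_simps)
  also have "\<dots> = (c / sqrt S)\<^sup>2"
    using \<open>0 < S\<close> by (simp add: power_divide)
  finally have "(MIN t\<in>{..<T}. b t) \<le> c / sqrt S"
    by (rule power2_le_imp_le) (use \<open>0 < S\<close> c in simp)
  also have "\<dots> = c * S powr (- 1 / 2)"
    using \<open>0 < S\<close> powr_minus_divide[of S "1 / 2"] by (simp add: powr_half_sqrt)
  finally show ?thesis by (simp add: S_def)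
qed

text \<open>
  Write \<open>S T\<close> for the sum of the first \<open>T\<close> weights and \<open>m T\<close> for the minimum.  For fixed \<open>N\<close> the
  quantity \<open>(m T)\<^sup>2 * (S T - S N)\<close> is at most the tail from \<open>N\<close> of a convergent series, and
  \<open>S T - S N \<ge> S T / 2\<close> as soon as \<open>S T\<close> exceeds \<open>2 * S N\<close>.  Hence \<open>(m T)\<^sup>2 * S T\<close> is eventually
  smaller than any given positive number.
\<close>

lemma min_rate_smallo:
  fixes \<mu> b :: "nat \<Rightarrow> real"
  assumes b: "\<And>t. 0 \<le> b t" and \<mu>: "\<And>t. 0 < \<mu> t"
    and div: "filterlim (\<lambda>T. \<Sum>t<T. \<mu> t) at_top sequentially"
    and sum: "summable (\<lambda>t. \<mu> t * (b t)\<^sup>2)"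
  shows "(\<lambda>T. MIN t\<in>{..<T}. b t) \<in> o(\<lambda>T. (\<Sum>t<T. \<mu> t) powr (- 1 / 2))"
proof (rule landau_o.smallI)
  fix e :: real
  assume "0 < e"
  define f where "f t = \<mu> t * (b t)\<^sup>2" for t
  define S where "S T = (\<Sum>t<T. \<mu> t)" for T
  define m where "m T = (MIN t\<in>{..<T}. b t)" for T
  have f: "summable f" "\<And>t. 0 \<le> f t"
    using sum \<mu> by (auto simp: f_def[abs_def] less_imp_le)
  have "(\<lambda>T. sum f {..<T}) \<longlonglongrightarrow> suminf f"
    using f(1) by (rule summable_LIMSEQ)
  then have "\<forall>\<^sub>F N in sequentially. suminf f - e\<^sup>2 / 2 < sum f {..<N}"
    using \<open>0 < e\<close> by (intro order_tendstoD) auto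
  \<comment> \<open>The tail beyond \<open>N\<close> is below \<open>e\<^sup>2 / 2\<close>; the other factor two is lost in \<open>S T - S N \<ge> S T / 2\<close>.\<close>
  then obtain N where N: "suminf f - e\<^sup>2 / 2 < sum f {..<N}"
    by (auto simp: eventually_sequentially)
  have "\<forall>\<^sub>F T in sequentially. 2 * S N < S T"
    using div by (auto simp: S_def[abs_def] filterlim_at_top_dense)
  then show "\<forall>\<^sub>F T in sequentially. norm (MIN t\<in>{..<T}. b t) \<le> e * norm ((\<Sum>t<T. \<mu> t) powr (- 1 / 2))"
    using eventually_ge_at_top[of "max N 1"]
  proof eventually_elim
    case (elim T)
    have T: "N \<le> T" "1 \<le> T" using elim by auto
    have "0 \<le> S N"
      unfolding S_def using \<mu> by (intro sum_nonneg) (simp add: less_imp_le)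
    then have "0 < S T" using elim by linarith
    have "{..<T} \<noteq> {}" using T by (auto simp: lessThan_empty_iff)
    then have m_nonneg: "0 \<le> m T" using b by (auto simp: m_def)
    have split: "sum g {..<T} = sum g {..<N} + sum g {N..<T}" for g :: "nat \<Rightarrow> real"
      using T(1) by (metis atLeast0LessThan le0 sum.atLeastLessThan_concat)
    have "(m T)\<^sup>2 * (S T - S N) \<le> sum f {N..<T}"
      using weighted_min_square_le[of b \<mu> N T] b \<mu> T split[of \<mu>]
      by (simp add: m_def S_def f_def[abs_def] less_imp_le)
    also have "\<dots> = sum f {..<T} - sum f {..<N}"
      using split[of f] by simp
    also have "\<dots> \<le> e\<^sup>2 / 2"
      using N sum_le_suminf[OF f(1), of "{..<T}"] f(2) by simp
    finally have "(m T)\<^sup>2 * (S T - S N) \<le> e\<^sup>2 / 2" .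
    moreover have "(m T)\<^sup>2 * (S T / 2) \<le> (m T)\<^sup>2 * (S T - S N)"
      using elim by (intro mult_left_mono) auto
    ultimately have "(m T)\<^sup>2 * S T \<le> e\<^sup>2"
      by linarith
    then have "(m T)\<^sup>2 \<le> (e / sqrt (S T))\<^sup>2"
      using \<open>0 < S T\<close> by (simp add: pos_le_divide_eq power_divide)
    then have "m T \<le> e / sqrt (S T)"
      by (rule power2_le_imp_le) (use \<open>0 < S T\<close> \<open>0 < e\<close> in simp)
    also have "\<dots> = e * S T powr (- 1 / 2)"
      using \<open>0 < S T\<close> powr_minus_divide[of "S T" "1 / 2"] by (simp add: powr_half_sqrt)
    finally show ?case
      using m_nonneg by (simp add: m_def S_def)
  qed
qed

section \<open>Independence and sample means\<close>

lemma (in prob_space) integrable_finite_range: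
  fixes h :: "'a \<Rightarrow> 'b::{banach, second_countable_topology}"
  assumes "h \<in> borel_measurable M" "finite (h ` space M)"
  shows "integrable M h"
proof (rule integrable_const_bound)
  show "AE \<omega> in M. norm (h \<omega>) \<le> Max (norm ` h ` space M)"
    using assms(2) by (intro AE_I2 Max_ge) auto
qed (fact assms(1))

text \<open>
  Conditioning on the past: \<open>F (Z \<omega>)\<close> may be held fixed while the expectation over the independent
  \<open>Y\<close> is taken.  As \<open>F (Z \<omega>)\<close> takes finitely many values, splitting into the events \<open>F (Z \<omega>) = x\<close>
  reduces this to the product rule for expectations of independent factors.
\<close>

lemma (in prob_space) expectation_freeze:
  fixes f :: "'s \<Rightarrow> 'c \<Rightarrow> real" and F :: "'c \<Rightarrow> 's"
  assumes indep: "indep_var (count_space UNIV) Z (count_space UNIV) Y"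
    and fin: "finite ((\<lambda>\<omega>. F (Z \<omega>)) ` space M)"
    and int: "\<And>x. integrable M (\<lambda>\<omega>. f x (Y \<omega>))"
  shows "expectation (\<lambda>\<omega>. f (F (Z \<omega>)) (Y \<omega>))
      = expectation (\<lambda>\<omega>. expectation (\<lambda>\<omega>'. f (F (Z \<omega>)) (Y \<omega>')))"
proof -
  define D :: "'s \<Rightarrow> 'a \<Rightarrow> real" where "D x \<omega> = indicator {x} (F (Z \<omega>))" for x \<omega>
  have split: "g (F (Z \<omega>)) = (\<Sum>x\<in>(\<lambda>\<omega>. F (Z \<omega>)) ` space M. D x \<omega> * g x)" if "\<omega> \<in> space M" for \<omega> and g :: "'s \<Rightarrow> real"
  proof -
    have "(\<Sum>x\<in>(\<lambda>\<omega>. F (Z \<omega>)) ` space M. D x \<omega> * g x) = (\<Sum>x\<in>(\<lambda>\<omega>. F (Z \<omega>)) ` space M. if x = F (Z \<omega>) then g x else 0)"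
      by (intro sum.cong) (auto simp: D_def indicator_def)
    then show ?thesis
      using fin that by simp
  qed
  have Z: "Z \<in> measurable M (count_space UNIV)"
    using indep by (rule indep_var_rv1)
  have D_int: "integrable M (D x)" for x
    unfolding D_def[abs_def]
    by (rule integrable_const_bound[where B = 1])
      (auto intro!: measurable_compose[OF Z] simp: indicator_def)
  have ind: "indep_var borel (D x) borel (\<lambda>\<omega>. f x (Y \<omega>))" for x
    using indep_var_compose[OF indep, of "\<lambda>i. indicator {x} (F i)" borel "f x" borel]
    by (simp add: D_def[abs_def] comp_def)
  have prod_int: "integrable M (\<lambda>\<omega>. D x \<omega> * f x (Y \<omega>))" for x
    by (rule indep_var_integrable[OF ind D_int int])
  have "expectation (\<lambda>\<omega>. f (F (Z \<omega>)) (Y \<omega>)) = expectation (\<lambda>\<omega>. \<Sum>x\<in>(\<lambda>\<omega>. F (Z \<omega>)) ` space M. D x \<omega> * f x (Y \<omega>))"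
    by (rule Bochner_Integration.integral_cong) (auto intro: split)
  also have "\<dots> = (\<Sum>x\<in>(\<lambda>\<omega>. F (Z \<omega>)) ` space M. expectation (\<lambda>\<omega>. D x \<omega> * f x (Y \<omega>)))"
    by (intro Bochner_Integration.integral_sum prod_int)
  also have "\<dots> = (\<Sum>x\<in>(\<lambda>\<omega>. F (Z \<omega>)) ` space M. expectation (\<lambda>\<omega>. D x \<omega> * expectation (\<lambda>\<omega>'. f x (Y \<omega>'))))"
    using indep_var_lebesgue_integral[OF ind D_int int] by simp
  also have "\<dots> = expectation (\<lambda>\<omega>. \<Sum>x\<in>(\<lambda>\<omega>. F (Z \<omega>)) ` space M. D x \<omega> * expectation (\<lambda>\<omega>'. f x (Y \<omega>')))"
    by (intro Bochner_Integration.integral_sum[symmetric] integrable_mult_left D_int)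
  also have "\<dots> = expectation (\<lambda>\<omega>. expectation (\<lambda>\<omega>'. f (F (Z \<omega>)) (Y \<omega>')))"
    by (intro Bochner_Integration.integral_cong refl split[symmetric])
  finally show ?thesis .
qed

lemma (in prob_space) indep_vars_imp_indep_var:
  assumes "indep_vars M' X I" "i \<in> I" "j \<in> I" "i \<noteq> j"
  shows "indep_var (M' i) (X i) (M' j) (X j)"
  using indep_var_compose[OF indep_var_restrict[OF assms(1), of "{i}" "{j}"],
      of "\<lambda>f. f i" "M' i" "\<lambda>f. f j" "M' j"] assms
  by (auto simp: comp_def)

text \<open>
  The squared norm of the sum has \<open>K\<close> diagonal terms with mean \<open>q\<close> and \<open>K * (K - 1)\<close> off-diagonal
  terms, whose mean is \<open>\<parallel>m\<parallel>\<^sup>2\<close> by independence, applied coordinate by coordinate.  This is the origin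
  of the constant \<open>1 - 1 / K\<close>.
\<close>

lemma (in prob_space)
  fixes X :: "nat \<Rightarrow> 'a \<Rightarrow> 'e::euclidean_space"
  assumes K: "1 \<le> K"
    and indep: "indep_vars (\<lambda>_. borel) X {1..K}"
    and int: "\<And>k. k \<in> {1..K} \<Longrightarrow> integrable M (X k)"
    and sq_int: "\<And>k. k \<in> {1..K} \<Longrightarrow> integrable M (\<lambda>\<omega>. (norm (X k \<omega>))\<^sup>2)"
    and mean: "\<And>k. k \<in> {1..K} \<Longrightarrow> expectation (X k) = m"
    and sq_mean: "\<And>k. k \<in> {1..K} \<Longrightarrow> expectation (\<lambda>\<omega>. (norm (X k \<omega>))\<^sup>2) = q"
  shows integrable_square_sample_mean:
      "integrable M (\<lambda>\<omega>. (norm ((1 / real K) *\<^sub>R (\<Sum>k=1..K. X k \<omega>)))\<^sup>2)" (is ?int)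
    and expectation_square_sample_mean:
      "expectation (\<lambda>\<omega>. (norm ((1 / real K) *\<^sub>R (\<Sum>k=1..K. X k \<omega>)))\<^sup>2)
        = (1 - 1 / real K) * (norm m)\<^sup>2 + q / real K" (is ?eq)
proof -
  have pair: "integrable M (\<lambda>\<omega>. X k \<omega> \<bullet> X l \<omega>)"
    "expectation (\<lambda>\<omega>. X k \<omega> \<bullet> X l \<omega>) = (if k = l then q else m \<bullet> m)"
    if k: "k \<in> {1..K}" and l: "l \<in> {1..K}" for k l
  proof -
    have "integrable M (\<lambda>\<omega>. X k \<omega> \<bullet> X l \<omega>) \<and>
      expectation (\<lambda>\<omega>. X k \<omega> \<bullet> X l \<omega>) = (if k = l then q else m \<bullet> m)"
    proof (cases "k = l")
      case True
      then show ?thesis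
        using sq_int[OF k] sq_mean[OF k] by (simp add: power2_norm_eq_inner)
    next
      case False
      have ind: "indep_var borel (\<lambda>\<omega>. X k \<omega> \<bullet> b) borel (\<lambda>\<omega>. X l \<omega> \<bullet> b)" for b
        using indep_var_compose[OF indep_vars_imp_indep_var[OF indep k l False],
            of "\<lambda>x. x \<bullet> b" borel "\<lambda>x. x \<bullet> b" borel] by (simp add: comp_def)
      have comp_int: "integrable M (\<lambda>\<omega>. X j \<omega> \<bullet> b)" if "j \<in> {1..K}" for j b
        using int[OF that] by simp
      have comp_mean: "expectation (\<lambda>\<omega>. X j \<omega> \<bullet> b) = m \<bullet> b" if "j \<in> {1..K}" for j b
        using int[OF that] mean[OF that] by simp
      have "integrable M (\<lambda>\<omega>. \<Sum>b\<in>Basis. (X k \<omega> \<bullet> b) * (X l \<omega> \<bullet> b))"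
        using k l by (intro Bochner_Integration.integrable_sum indep_var_integrable ind comp_int)
      moreover have "expectation (\<lambda>\<omega>. \<Sum>b\<in>Basis. (X k \<omega> \<bullet> b) * (X l \<omega> \<bullet> b))
          = (\<Sum>b\<in>Basis. (m \<bullet> b) * (m \<bullet> b))"
        using k l by (simp add: Bochner_Integration.integral_sum indep_var_integrable[OF ind]
            indep_var_lebesgue_integral[OF ind] comp_int comp_mean)
      ultimately show ?thesis
        using False by (simp add: euclidean_inner[of "X k _" "X l _"] euclidean_inner[of m m])
    qed
    then show "integrable M (\<lambda>\<omega>. X k \<omega> \<bullet> X l \<omega>)"
      "expectation (\<lambda>\<omega>. X k \<omega> \<bullet> X l \<omega>) = (if k = l then q else m \<bullet> m)"
      by auto
  qed
  have expand: "(norm ((1 / real K) *\<^sub>R (\<Sum>k=1..K. X k \<omega>)))\<^sup>2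
      = (\<Sum>k=1..K. \<Sum>l=1..K. X k \<omega> \<bullet> X l \<omega>) / (real K)\<^sup>2" for \<omega>
  proof -
    have "(norm (\<Sum>k=1..K. X k \<omega>))\<^sup>2 = (\<Sum>k=1..K. \<Sum>l=1..K. X k \<omega> \<bullet> X l \<omega>)"
      unfolding power2_norm_eq_inner
      by (subst sum.swap) (simp add: inner_sum_left inner_sum_right)
    then show ?thesis
      by (simp add: power_divide)
  qed
  show ?int
    unfolding expand
    by (intro integrable_divide Bochner_Integration.integrable_sum pair)
  have "expectation (\<lambda>\<omega>. (norm ((1 / real K) *\<^sub>R (\<Sum>k=1..K. X k \<omega>)))\<^sup>2)
      = (\<Sum>k=1..K. \<Sum>l=1..K. if k = l then q else m \<bullet> m) / (real K)\<^sup>2"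
  proof -
    have "expectation (\<lambda>\<omega>. \<Sum>k=1..K. \<Sum>l=1..K. X k \<omega> \<bullet> X l \<omega>)
        = (\<Sum>k=1..K. expectation (\<lambda>\<omega>. \<Sum>l=1..K. X k \<omega> \<bullet> X l \<omega>))"
      by (intro Bochner_Integration.integral_sum Bochner_Integration.integrable_sum pair)
    also have "\<dots> = (\<Sum>k=1..K. \<Sum>l=1..K. expectation (\<lambda>\<omega>. X k \<omega> \<bullet> X l \<omega>))"
      by (intro sum.cong refl Bochner_Integration.integral_sum pair)
    also have "\<dots> = (\<Sum>k=1..K. \<Sum>l=1..K. if k = l then q else m \<bullet> m)"
      by (intro sum.cong refl pair)
    finally show ?thesis
      unfolding expand by simp
  qed
  also have "(\<Sum>k=1..K. \<Sum>l=1..K. if k = l then q else m \<bullet> m)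
      = (\<Sum>k=1..K. \<Sum>l=1..K. (m \<bullet> m) + (if k = l then q - m \<bullet> m else 0))"
    by (intro sum.cong) auto
  also have "\<dots> = (real K)\<^sup>2 * (m \<bullet> m) + real K * (q - m \<bullet> m)"
    by (simp add: sum.distrib power2_eq_square algebra_simps)
  also have "\<dots> / (real K)\<^sup>2 = (1 - 1 / real K) * (norm m)\<^sup>2 + q / real K"
    using K unfolding dot_square_norm by (simp add: field_simps power2_eq_square)
  finally show ?eq .
qed

lemma (in prob_space)
  fixes h :: "nat \<Rightarrow> 'b::{banach, second_countable_topology}"
  assumes meas: "I \<in> measurable M (count_space UNIV)"
    and law: "distr M (count_space UNIV) I = measure_pmf p"
    and fin: "finite S" and supp: "set_pmf p \<subseteq> S"
  shows integrable_draw: "integrable M (\<lambda>\<omega>. h (I \<omega>))"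
    and expectation_draw: "expectation (\<lambda>\<omega>. h (I \<omega>)) = (\<Sum>r\<in>S. pmf p r *\<^sub>R h r)"
proof -
  have "integrable (measure_pmf p) h"
    using fin supp by (intro integrable_measure_pmf_finite) (rule finite_subset)
  then show "integrable M (\<lambda>\<omega>. h (I \<omega>))"
    unfolding law[symmetric] using meas by (subst (asm) integrable_distr_eq) auto
  have "expectation (\<lambda>\<omega>. h (I \<omega>)) = measure_pmf.expectation p h"
    unfolding law[symmetric] using meas by (subst integral_distr) auto
  also have "\<dots> = (\<Sum>r\<in>S. pmf p r *\<^sub>R h r)"
    using supp by (intro integral_measure_pmf fin) auto
  finally show "expectation (\<lambda>\<omega>. h (I \<omega>)) = (\<Sum>r\<in>S. pmf p r *\<^sub>R h r)" .
qed

section \<open>Expected decrease in one step\<close>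

text \<open>
  This holds for arbitrary index sequences, also those that leave the support of \<open>p\<close>: outside the
  support the weight \<open>1 / pmf p r\<close> is zero.  Hence the iterates take finitely many values on the whole
  probability space, and all integrability questions are settled without exceptional null sets.
\<close>

lemma finite_range_stoch_grad:
  assumes "finite (set_pmf p)"
  shows "finite (range (\<lambda>i. stoch_grad A y \<epsilon> B p K i x))"
proof -
  define w where "w r = (1 / pmf p r) *\<^sub>R amp_grad (block (B r) A) (block (B r) y) \<epsilon> x" for r
  have "range w \<subseteq> insert 0 (w ` set_pmf p)"
    by (auto simp: w_def set_pmf_iff)
  then have "finite (range w)"
    by (rule finite_subset) (simp add: assms)
  then have "finite ((\<lambda>g. (1 / real K) *\<^sub>R (\<Sum>k=1..K. g k)) ` (PiE {1..K} (\<lambda>_. range w)))"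
    by (intro finite_imageI[OF finite_PiE]) simp_all
  moreover have "range (\<lambda>i. stoch_grad A y \<epsilon> B p K i x)
      \<subseteq> (\<lambda>g. (1 / real K) *\<^sub>R (\<Sum>k=1..K. g k)) ` (PiE {1..K} (\<lambda>_. range w))"
  proof (rule image_subsetI)
    fix i
    show "stoch_grad A y \<epsilon> B p K i x
        \<in> (\<lambda>g. (1 / real K) *\<^sub>R (\<Sum>k=1..K. g k)) ` (PiE {1..K} (\<lambda>_. range w))"
      by (rule image_eqI[where x = "restrict (\<lambda>k. w (i k)) {1..K}"])
        (simp_all add: stoch_grad_def w_def)
  qed
  ultimately show ?thesis
    by (rule finite_subset[rotated])
qed

lemma stoch_grad_cong:
  assumes "\<And>k. k \<in> {1..K} \<Longrightarrow> i k = j k"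
  shows "stoch_grad A y \<epsilon> B p K i x = stoch_grad A y \<epsilon> B p K j x"
  unfolding stoch_grad_def using assms by simp

text \<open>
  The factor by which the loss bounds the second moment of \<open>A\<close> applied to one reweighted block
  gradient.
\<close>

definition block_variance_bound ::
    "complex ^ 'd::finite ^ 'm::finite \<Rightarrow> (nat \<Rightarrow> 'm set) \<Rightarrow> nat pmf \<Rightarrow> nat set \<Rightarrow> real" where
  "block_variance_bound A B p S =
     (\<Sum>r\<in>S. (spectral_norm A)\<^sup>2 * (spectral_norm (block (B r) A))\<^sup>2 / pmf p r)"

lemma block_variance_bound_nonneg: "0 \<le> block_variance_bound A B p S"
  unfolding block_variance_bound_def by (intro sum_nonneg) simp

text \<open>
  Weight \<open>p\<^sub>r\<close> and reweighting \<open>1 / p\<^sub>r\<^sup>2\<close> leave \<open>\<parallel>A \<nabla>\<L>\<^sub>r\<parallel>\<^sup>2 / p\<^sub>r\<close>, in which the block gradient is bounded by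
  the block loss and the block loss by the total loss.
\<close>

lemma block_second_moment_le:
  fixes A :: "complex ^ 'd::finite ^ 'm::finite"
  assumes "0 \<le> \<epsilon>" "finite S" "disjoint_family_on B S" "(\<Union>r\<in>S. B r) = UNIV"
    and pos: "\<And>r. r \<in> S \<Longrightarrow> 0 < pmf p r"
  shows "(\<Sum>r\<in>S. pmf p r *
      (norm ((1 / pmf p r) *\<^sub>R (A *v amp_grad (block (B r) A) (block (B r) y) \<epsilon> x)))\<^sup>2)
    \<le> block_variance_bound A B p S * amp_loss A y \<epsilon> x"
  unfolding block_variance_bound_def sum_distrib_right
proof (rule sum_mono)
  fix r assume r: "r \<in> S"
  define g where "g = amp_grad (block (B r) A) (block (B r) y) \<epsilon> x"
  define a where "a = spectral_norm A"
  define a' where "a' = spectral_norm (block (B r) A)"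
  have "amp_loss (block (B r) A) (block (B r) y) \<epsilon> x \<le> amp_loss A y \<epsilon> x"
    using member_le_sum[of r S "\<lambda>r. amp_loss (block (B r) A) (block (B r) y) \<epsilon> x"] r assms(2)
    by (simp add: amp_loss_nonneg amp_loss_blocks[OF assms(2-4)])
  then have g_le: "(norm g)\<^sup>2 \<le> a'\<^sup>2 * amp_loss A y \<epsilon> x"
    using amp_grad_norm_le_loss[OF assms(1), of "block (B r) A" "block (B r) y" x]
    unfolding g_def a'_def by (meson mult_left_mono order_trans zero_le_power2)
  have "(norm (A *v g))\<^sup>2 \<le> (a * norm g)\<^sup>2"
    unfolding a_def by (intro power_mono norm_mult_vec_le) simp
  also have "\<dots> \<le> a\<^sup>2 * (a'\<^sup>2 * amp_loss A y \<epsilon> x)"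
    unfolding power_mult_distrib by (intro mult_left_mono g_le) simp
  finally have "(norm (A *v g))\<^sup>2 / pmf p r \<le> a\<^sup>2 * (a'\<^sup>2 * amp_loss A y \<epsilon> x) / pmf p r"
    by (rule divide_right_mono) simp
  moreover have "pmf p r * (norm ((1 / pmf p r) *\<^sub>R (A *v g)))\<^sup>2 = (norm (A *v g))\<^sup>2 / pmf p r"
    using pos[OF r] by (simp add: power_divide power2_eq_square)
  ultimately show "pmf p r *
      (norm ((1 / pmf p r) *\<^sub>R (A *v amp_grad (block (B r) A) (block (B r) y) \<epsilon> x)))\<^sup>2
      \<le> (spectral_norm A)\<^sup>2 * (spectral_norm (block (B r) A))\<^sup>2 / pmf p r * amp_loss A y \<epsilon> x"
    by (simp only: g_def a_def a'_def times_divide_eq_left mult.assoc)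
qed

text \<open>
  Insert \<open>h = - \<mu> g\<close> into the quadratic majorization.  The linear term has mean \<open>- 2 \<mu> \<parallel>\<nabla>\<L>\<parallel>\<^sup>2\<close>, because \<open>g\<close>
  is unbiased.  The quadratic term splits into the squared mean, which the step size condition
  bounds by \<open>\<mu> \<parallel>\<nabla>\<L>\<parallel>\<^sup>2\<close>, and a remainder that is at most \<open>\<mu>\<^sup>2\<close> times a multiple of the loss.
\<close>

lemma (in prob_space)
  fixes A :: "complex ^ 'd::finite ^ 'm::finite" and i :: "nat \<Rightarrow> 'a \<Rightarrow> nat"
  assumes y: "\<And>j. 0 \<le> y $ j" and eps: "0 \<le> \<epsilon>"
    and S: "finite S" "disjoint_family_on B S" "(\<Union>r\<in>S. B r) = UNIV"
    and p: "set_pmf p \<subseteq> S" "\<And>r. r \<in> S \<Longrightarrow> 0 < pmf p r"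
    and K: "1 \<le> K"
    and indep: "indep_vars (\<lambda>_. count_space UNIV) i {1..K}"
    and law: "\<And>k. k \<in> {1..K} \<Longrightarrow> distr M (count_space UNIV) (i k) = measure_pmf p"
    and mu: "0 \<le> \<mu>" "(1 - 1 / real K) * (spectral_norm A)\<^sup>2 * \<mu> \<le> 1"
  shows integrable_loss_step:
      "integrable M (\<lambda>\<omega>. amp_loss A y \<epsilon> (x - \<mu> *\<^sub>R stoch_grad A y \<epsilon> B p K (\<lambda>k. i k \<omega>) x))"
        (is ?int)
    and expected_loss_step:
      "expectation (\<lambda>\<omega>. amp_loss A y \<epsilon> (x - \<mu> *\<^sub>R stoch_grad A y \<epsilon> B p K (\<lambda>k. i k \<omega>) x))
        \<le> (1 + block_variance_bound A B p S * \<mu>\<^sup>2) * amp_loss A y \<epsilon> x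
            - \<mu> * (norm (amp_grad A y \<epsilon> x))\<^sup>2" (is ?le)
proof -
  define G where "G r = amp_grad (block (B r) A) (block (B r) y) \<epsilon> x" for r
  define w where "w r = (1 / pmf p r) *\<^sub>R G r" for r
  define g where "g \<omega> = stoch_grad A y \<epsilon> B p K (\<lambda>k. i k \<omega>) x" for \<omega>
  define D where "D = amp_grad A y \<epsilon> x"
  define Q where "Q = (\<Sum>r\<in>S. pmf p r * (norm (A *v w r))\<^sup>2)"
  have g_eq: "g \<omega> = (1 / real K) *\<^sub>R (\<Sum>k=1..K. w (i k \<omega>))" for \<omega>
    by (simp add: g_def stoch_grad_def w_def G_def)
  interpret A: bounded_linear "(*v) A"
    by (rule matrix_vector_mul_bounded_linear)
  have Ag_eq: "A *v g \<omega> = (1 / real K) *\<^sub>R (\<Sum>k=1..K. A *v w (i k \<omega>))" for \<omega>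
    by (simp add: g_eq A.scaleR A.sum)
  have meas: "i k \<in> measurable M (count_space UNIV)" if "k \<in> {1..K}" for k
    using indep that by (auto simp: indep_vars_def)
  note draw_int = integrable_draw[OF meas law S(1) p(1)]
  note draw_mean = expectation_draw[OF meas law S(1) p(1)]
  have sum_w: "(\<Sum>r\<in>S. pmf p r *\<^sub>R w r) = D"
  proof -
    have "(\<Sum>r\<in>S. pmf p r *\<^sub>R w r) = (\<Sum>r\<in>S. G r)"
      using p(2) by (intro sum.cong) (auto simp: w_def less_imp_neq[symmetric])
    then show ?thesis
      by (simp add: G_def D_def amp_grad_blocks[OF S])
  qed
  have g_int: "integrable M g"
    unfolding g_eq[abs_def]
    by (intro integrable_scaleR_right Bochner_Integration.integrable_sum draw_int)
  have g_mean: "expectation g = D"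
  proof -
    have w_mean: "expectation (\<lambda>\<omega>. w (i k \<omega>)) = D" if "k \<in> {1..K}" for k
      using draw_mean[OF that that, of w] sum_w by simp
    have "expectation (\<lambda>\<omega>. \<Sum>k=1..K. w (i k \<omega>)) = (\<Sum>k=1..K. expectation (\<lambda>\<omega>. w (i k \<omega>)))"
      by (intro Bochner_Integration.integral_sum draw_int)
    also have "\<dots> = real K *\<^sub>R D"
      using w_mean by (simp add: sum_constant_scaleR del: sum_constant)
    finally show ?thesis
      unfolding g_eq[abs_def] using K by simp
  qed
  have Aw_ind: "indep_vars (\<lambda>_. borel) (\<lambda>k \<omega>. A *v w (i k \<omega>)) {1..K}"
    by (rule indep_vars_compose2[OF indep]) simp
  have Aw_mean: "expectation (\<lambda>\<omega>. A *v w (i k \<omega>)) = A *v D" if "k \<in> {1..K}" for k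
    using draw_mean[OF that that, of "\<lambda>r. A *v w r"]
    unfolding sum_w[symmetric] A.sum A.scaleR .
  have Aw_sq: "expectation (\<lambda>\<omega>. (norm (A *v w (i k \<omega>)))\<^sup>2) = Q" if "k \<in> {1..K}" for k
    using draw_mean[OF that that, of "\<lambda>r. (norm (A *v w r))\<^sup>2"] by (simp add: Q_def)
  note sample = K Aw_ind draw_int draw_int Aw_mean Aw_sq
  have Ag_int: "integrable M (\<lambda>\<omega>. (norm (A *v g \<omega>))\<^sup>2)"
    unfolding Ag_eq by (rule integrable_square_sample_mean[OF sample])
  have Ag_mean: "expectation (\<lambda>\<omega>. (norm (A *v g \<omega>))\<^sup>2)
      = (1 - 1 / real K) * (norm (A *v D))\<^sup>2 + Q / real K"
    unfolding Ag_eq by (rule expectation_square_sample_mean[OF sample])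
  have Q_le: "Q \<le> block_variance_bound A B p S * amp_loss A y \<epsilon> x"
    using block_second_moment_le[OF eps S p(2), of A y x]
    by (simp add: Q_def w_def G_def A.scaleR)
  define U where "U \<omega> = amp_loss A y \<epsilon> x - 2 * \<mu> * (D \<bullet> g \<omega>) + \<mu>\<^sup>2 * (norm (A *v g \<omega>))\<^sup>2" for \<omega>
  have loss_le: "amp_loss A y \<epsilon> (x - \<mu> *\<^sub>R g \<omega>) \<le> U \<omega>" for \<omega>
    using amp_loss_majorization[OF y eps, of A x "- (\<mu> *\<^sub>R g \<omega>)"]
    by (simp add: U_def D_def A.neg A.scaleR power_mult_distrib)
  have U_int: "integrable M U"
    unfolding U_def[abs_def] using g_int Ag_int by simp
  have finp: "finite (set_pmf p)"
    using p(1) S(1) by (rule finite_subset)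
  show int: ?int
  proof (rule integrable_finite_range)
    have "finite ((\<lambda>v. amp_loss A y \<epsilon> (x - \<mu> *\<^sub>R v)) ` range (\<lambda>j. stoch_grad A y \<epsilon> B p K j x))"
      using finite_range_stoch_grad[OF finp] by (rule finite_imageI)
    then show "finite ((\<lambda>\<omega>. amp_loss A y \<epsilon> (x - \<mu> *\<^sub>R stoch_grad A y \<epsilon> B p K (\<lambda>k. i k \<omega>) x)) ` space M)"
      by (rule finite_subset[rotated]) auto
    have "g \<in> borel_measurable M"
      using g_int by simp
    moreover have "(\<lambda>v. amp_loss A y \<epsilon> (x - \<mu> *\<^sub>R v)) \<in> borel_measurable borel"
      unfolding amp_loss_eq_sum A.diff A.scaleR
      by (intro borel_measurable_continuous_onI continuous_intros
          linear_continuous_on matrix_vector_mul_bounded_linear) 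
    ultimately show "(\<lambda>\<omega>. amp_loss A y \<epsilon> (x - \<mu> *\<^sub>R stoch_grad A y \<epsilon> B p K (\<lambda>k. i k \<omega>) x))
        \<in> borel_measurable M"
      unfolding g_def[symmetric] by (rule measurable_compose)
  qed
  have "expectation (\<lambda>\<omega>. amp_loss A y \<epsilon> (x - \<mu> *\<^sub>R g \<omega>)) \<le> expectation U"
    using int U_int loss_le unfolding g_def by (intro integral_mono) auto
  also have "expectation U = amp_loss A y \<epsilon> x - 2 * \<mu> * (norm D)\<^sup>2
      + \<mu>\<^sup>2 * ((1 - 1 / real K) * (norm (A *v D))\<^sup>2 + Q / real K)"
    unfolding U_def[abs_def] using g_int Ag_int
    by (simp add: prob_space g_mean Ag_mean dot_square_norm)
  also have "\<dots> = amp_loss A y \<epsilon> x - 2 * \<mu> * (norm D)\<^sup>2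
      + \<mu>\<^sup>2 * (1 - 1 / real K) * (norm (A *v D))\<^sup>2 + \<mu>\<^sup>2 * (Q / real K)"
    by (simp add: algebra_simps)
  \<comment> \<open>One factor \<open>\<mu>\<close> is absorbed by the step size condition.\<close>
  also have "\<mu>\<^sup>2 * (1 - 1 / real K) * (norm (A *v D))\<^sup>2 \<le> \<mu> * (norm D)\<^sup>2"
  proof -
    have "(norm (A *v D))\<^sup>2 \<le> (spectral_norm A * norm D)\<^sup>2"
      by (intro power_mono norm_mult_vec_le) simp
    then have "\<mu>\<^sup>2 * (1 - 1 / real K) * (norm (A *v D))\<^sup>2
        \<le> \<mu>\<^sup>2 * (1 - 1 / real K) * (spectral_norm A * norm D)\<^sup>2"
      using K by (intro mult_left_mono) auto
    also have "\<dots> = (1 - 1 / real K) * (spectral_norm A)\<^sup>2 * \<mu> * (\<mu> * (norm D)\<^sup>2)"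
      by (simp only: power2_eq_square mult_ac)
    also have "\<dots> \<le> 1 * (\<mu> * (norm D)\<^sup>2)"
      using mu by (intro mult_right_mono) auto
    finally show ?thesis by simp
  qed
  also have "\<mu>\<^sup>2 * (Q / real K) \<le> \<mu>\<^sup>2 * (block_variance_bound A B p S * amp_loss A y \<epsilon> x)"
  proof (rule mult_left_mono)
    have "Q / real K \<le> Q / 1"
      using K by (intro divide_left_mono) (auto simp: Q_def intro!: sum_nonneg)
    then show "Q / real K \<le> block_variance_bound A B p S * amp_loss A y \<epsilon> x"
      using Q_le by simp
  qed simp
  finally show ?le
    by (simp add: g_def D_def algebra_simps)
qed

section \<open>The iteration as a function of its draws\<close>

text \<open>
  The iteration driven by a given array of block indices; \<open>i (t, k)\<close> is the \<open>k\<close>-th draw of iteration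
  \<open>t\<close>.  Making the dependence on the draws explicit shows that the iterate at time \<open>t\<close> is a function
  of the draws before \<open>t\<close>, which is what its independence of the next draws rests on.
\<close>

primrec saf_iterate ::
    "complex ^ 'd::finite ^ 'm::finite \<Rightarrow> real ^ 'm \<Rightarrow> real \<Rightarrow> (nat \<Rightarrow> 'm set) \<Rightarrow> nat pmf \<Rightarrow> nat
      \<Rightarrow> (nat \<Rightarrow> real) \<Rightarrow> complex ^ 'd \<Rightarrow> (nat \<times> nat \<Rightarrow> nat) \<Rightarrow> nat \<Rightarrow> complex ^ 'd" where
  "saf_iterate A y \<epsilon> B p K \<mu> z0 i 0 = z0"
| "saf_iterate A y \<epsilon> B p K \<mu> z0 i (Suc t) =
     saf_iterate A y \<epsilon> B p K \<mu> z0 i t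
       - \<mu> t *\<^sub>R stoch_grad A y \<epsilon> B p K (\<lambda>k. i (t, k)) (saf_iterate A y \<epsilon> B p K \<mu> z0 i t)"

lemma saf_iterate_cong:
  assumes "\<And>s k. s < t \<Longrightarrow> k \<in> {1..K} \<Longrightarrow> i (s, k) = j (s, k)"
  shows "saf_iterate A y \<epsilon> B p K \<mu> z0 i t = saf_iterate A y \<epsilon> B p K \<mu> z0 j t"
  using assms
proof (induction t)
  case (Suc t)
  have IH: "saf_iterate A y \<epsilon> B p K \<mu> z0 i t = saf_iterate A y \<epsilon> B p K \<mu> z0 j t"
    using Suc by simp
  have "stoch_grad A y \<epsilon> B p K (\<lambda>k. i (t, k)) x = stoch_grad A y \<epsilon> B p K (\<lambda>k. j (t, k)) x" for x
    using Suc.prems by (intro stoch_grad_cong) auto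
  then show ?case
    by (simp add: IH)
qed simp

lemma finite_range_saf_iterate:
  assumes "finite (set_pmf p)"
  shows "finite (range (\<lambda>i. saf_iterate A y \<epsilon> B p K \<mu> z0 i t))"
proof (induction t)
  case (Suc t)
  let ?Z = "range (\<lambda>i. saf_iterate A y \<epsilon> B p K \<mu> z0 i t)"
  have "finite (\<Union>x\<in>?Z. (\<lambda>v. x - \<mu> t *\<^sub>R v) ` range (\<lambda>j. stoch_grad A y \<epsilon> B p K j x))"
    by (intro finite_UN_I Suc finite_imageI[OF finite_range_stoch_grad[OF assms]])
  then show ?case
    by (rule finite_subset[rotated]) auto
qed simp

text \<open>
  Restrictions to a finite index set range over a countable space, whose product sigma-algebra is the
  discrete one.  With independence stated for discrete sigma-algebras, arbitrary functions of the draws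
  can be used without a measurability argument.
\<close>

lemma (in prob_space) indep_var_restrict_discrete:
  fixes X :: "'i \<Rightarrow> 'a \<Rightarrow> nat"
  assumes indep: "indep_vars (\<lambda>_. count_space UNIV) X I"
    and J: "finite J" "J \<subseteq> I" and J': "finite J'" "J' \<subseteq> I" and disj: "J \<inter> J' = {}"
  shows "indep_var (count_space UNIV) (\<lambda>\<omega>. restrict (\<lambda>i. X i \<omega>) J)
    (count_space UNIV) (\<lambda>\<omega>. restrict (\<lambda>i. X i \<omega>) J')"
proof -
  have discrete: "PiM L (\<lambda>_. count_space (UNIV :: nat set)) = count_space (PiE L (\<lambda>_. UNIV))"
    if "finite L" for L :: "'i set"
    using that by (rule count_space_PiM_finite) simp
  show ?thesis
    using indep_var_compose[OF indep_var_restrict[OF indep disj J(2) J'(2)],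
        of "\<lambda>f. f" "count_space UNIV" "\<lambda>f. f" "count_space UNIV"]
    by (simp add: discrete J(1) J'(1) comp_def)
qed

lemma (in prob_space) integrable_saf_iterate:
  fixes h :: "complex ^ 'd::finite \<Rightarrow> real"
  assumes indep: "indep_vars (\<lambda>_. count_space UNIV) (\<lambda>(t, k). \<rho> t k) (UNIV \<times> {1..K})"
    and fin: "finite (set_pmf p)"
  shows "integrable M (\<lambda>\<omega>. h (saf_iterate A y \<epsilon> B p K \<mu> z0 (\<lambda>(s, k). \<rho> s k \<omega>) t))"
proof (rule integrable_finite_range)
  let ?H = "\<lambda>\<omega>. restrict (\<lambda>i. (case i of (s, k) \<Rightarrow> \<rho> s k) \<omega>) ({..<t} \<times> {1..K})"
  let ?F = "\<lambda>i. saf_iterate A y \<epsilon> B p K \<mu> z0 i t"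
  have "?H \<in> measurable M (count_space UNIV)"
    by (rule indep_var_rv1, rule indep_var_restrict_discrete[OF indep, where J' = "{}"]) auto
  then have "(\<lambda>\<omega>. h (?F (?H \<omega>))) \<in> borel_measurable M"
    by (rule measurable_compose) simp
  moreover have "?F (?H \<omega>) = ?F (\<lambda>(s, k). \<rho> s k \<omega>)" for \<omega>
    by (rule saf_iterate_cong) simp
  ultimately show "(\<lambda>\<omega>. h (?F (\<lambda>(s, k). \<rho> s k \<omega>))) \<in> borel_measurable M"
    by simp
  show "finite ((\<lambda>\<omega>. h (?F (\<lambda>(s, k). \<rho> s k \<omega>))) ` space M)"
    by (rule finite_subset[OF _ finite_imageI[OF finite_range_saf_iterate[OF fin], of h]]) blast
qed

lemma (in prob_space) indep_draws_of_iteration: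
  assumes "indep_vars (\<lambda>_. count_space UNIV) (\<lambda>(t, k). \<rho> t k) (UNIV \<times> {1..K})"
  shows "indep_vars (\<lambda>_. count_space UNIV) (\<rho> t) {1..K :: nat}"
proof -
  have "indep_vars (\<lambda>k. PiM {(t, k)} (\<lambda>_. count_space UNIV))
      (\<lambda>k \<omega>. restrict (\<lambda>i. (case i of (s, l) \<Rightarrow> \<rho> s l) \<omega>) {(t, k)}) {1..K}"
    by (rule indep_vars_restrict[OF assms, where K = "\<lambda>k. {(t, k)}"])
      (auto simp: disjoint_family_on_def)
  from indep_vars_compose2[OF this, of "\<lambda>k f. f (t, k)" "\<lambda>_. count_space UNIV"]
  show ?thesis
    by simp
qed

text \<open>
  The iterate depends only on the draws \<open>H\<close> of earlier iterations, which are independent of the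
  current draws \<open>Y\<close>.  Therefore the one-step estimate for a fixed point may be averaged over the
  distribution of the iterate.
\<close>

lemma (in prob_space) expected_loss_recursion:
  fixes A :: "complex ^ 'd::finite ^ 'm::finite"
  assumes y: "\<And>j. 0 \<le> y $ j" and eps: "0 \<le> \<epsilon>"
    and S: "finite S" "disjoint_family_on B S" "(\<Union>r\<in>S. B r) = UNIV"
    and p: "set_pmf p \<subseteq> S" "\<And>r. r \<in> S \<Longrightarrow> 0 < pmf p r"
    and K: "1 \<le> K"
    and indep: "indep_vars (\<lambda>_. count_space UNIV) (\<lambda>(t, k). \<rho> t k) (UNIV \<times> {1..K})"
    and law: "\<And>t k. k \<in> {1..K} \<Longrightarrow> distr M (count_space UNIV) (\<rho> t k) = measure_pmf p"
    and mu: "0 \<le> \<mu> t" "(1 - 1 / real K) * (spectral_norm A)\<^sup>2 * \<mu> t \<le> 1"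
    and Z: "\<And>t \<omega>. Z t \<omega> = saf_iterate A y \<epsilon> B p K \<mu> z0 (\<lambda>(s, k). \<rho> s k \<omega>) t"
  shows "expectation (\<lambda>\<omega>. amp_loss A y \<epsilon> (Z (Suc t) \<omega>))
    \<le> (1 + block_variance_bound A B p S * (\<mu> t)\<^sup>2) * expectation (\<lambda>\<omega>. amp_loss A y \<epsilon> (Z t \<omega>))
        - expectation (\<lambda>\<omega>. \<mu> t * (norm (amp_grad A y \<epsilon> (Z t \<omega>)))\<^sup>2)"
proof -
  define H where "H \<omega> = restrict (\<lambda>i. (case i of (s, k) \<Rightarrow> \<rho> s k) \<omega>) ({..<t} \<times> {1..K})" for \<omega>
  define Y where "Y \<omega> = restrict (\<lambda>i. (case i of (s, k) \<Rightarrow> \<rho> s k) \<omega>) ({t} \<times> {1..K})" for \<omega>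
  define F where "F i = saf_iterate A y \<epsilon> B p K \<mu> z0 i t" for i
  define f where "f x i = amp_loss A y \<epsilon> (x - \<mu> t *\<^sub>R stoch_grad A y \<epsilon> B p K (\<lambda>k. i (t, k)) x)"
    for x :: "complex ^ 'd" and i :: "nat \<times> nat \<Rightarrow> nat"
  let ?V = "block_variance_bound A B p S"
  have f_Y: "f x (Y \<omega>) = amp_loss A y \<epsilon> (x - \<mu> t *\<^sub>R stoch_grad A y \<epsilon> B p K (\<lambda>k. \<rho> t k \<omega>) x)" for x \<omega>
    unfolding f_def Y_def by (subst stoch_grad_cong[where j = "\<lambda>k. \<rho> t k \<omega>"]) auto
  have Z_F: "Z t \<omega> = F (H \<omega>)" for \<omega>
    unfolding Z F_def H_def by (rule saf_iterate_cong) simp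
  have ind: "indep_var (count_space UNIV) H (count_space UNIV) Y"
    unfolding H_def[abs_def] Y_def[abs_def]
    by (rule indep_var_restrict_discrete[OF indep]) auto
  have fin: "finite ((\<lambda>\<omega>. F (H \<omega>)) ` space M)"
    using finite_range_saf_iterate[OF finite_subset[OF p(1) S(1)], of A y \<epsilon> B K \<mu> z0 t]
    unfolding F_def by (rule finite_subset[rotated]) auto
  note step = y eps S p K indep_draws_of_iteration[OF indep] law mu
  have f_int: "integrable M (\<lambda>\<omega>. f x (Y \<omega>))" for x
    unfolding f_Y by (rule integrable_loss_step[OF step])
  have f_le: "expectation (\<lambda>\<omega>. f x (Y \<omega>))
      \<le> (1 + ?V * (\<mu> t)\<^sup>2) * amp_loss A y \<epsilon> x - \<mu> t * (norm (amp_grad A y \<epsilon> x))\<^sup>2" for x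
    unfolding f_Y by (rule expected_loss_step[OF step])
  have int: "integrable M (\<lambda>\<omega>. h (F (H \<omega>)))" for h :: "_ \<Rightarrow> real"
    unfolding Z_F[symmetric] Z
    by (rule integrable_saf_iterate[OF indep finite_subset[OF p(1) S(1)]])
  have "expectation (\<lambda>\<omega>. amp_loss A y \<epsilon> (Z (Suc t) \<omega>)) = expectation (\<lambda>\<omega>. f (F (H \<omega>)) (Y \<omega>))"
    unfolding f_Y Z_F[symmetric] by (simp add: Z)
  also have "\<dots> = expectation (\<lambda>\<omega>. expectation (\<lambda>\<omega>'. f (F (H \<omega>)) (Y \<omega>')))"
    by (rule expectation_freeze[where F = F and f = f, OF ind fin f_int])
  also have "\<dots> \<le> expectation (\<lambda>\<omega>. (1 + ?V * (\<mu> t)\<^sup>2) * amp_loss A y \<epsilon> (F (H \<omega>))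
      - \<mu> t * (norm (amp_grad A y \<epsilon> (F (H \<omega>))))\<^sup>2)"
    by (intro integral_mono int f_le Bochner_Integration.integrable_diff integrable_mult_right)
  also have "\<dots> = (1 + ?V * (\<mu> t)\<^sup>2) * expectation (\<lambda>\<omega>. amp_loss A y \<epsilon> (F (H \<omega>)))
      - expectation (\<lambda>\<omega>. \<mu> t * (norm (amp_grad A y \<epsilon> (F (H \<omega>))))\<^sup>2)"
    by (subst Bochner_Integration.integral_diff) (auto intro: int)
  finally show ?thesis unfolding Z_F .
qed

lemma (in prob_space) square_expectation_le:
  fixes X :: "'a \<Rightarrow> real"
  assumes "integrable M X" "integrable M (\<lambda>\<omega>. (X \<omega>)\<^sup>2)"
  shows "(expectation X)\<^sup>2 \<le> expectation (\<lambda>\<omega>. (X \<omega>)\<^sup>2)"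
  using variance_eq[OF assms] variance_positive[of X] by simp

section \<open>Convergence of Stochastic Amplitude Flow\<close>

theorem theorem3p5:
  fixes A :: "complex ^ 'd::finite ^ 'm::finite"
    and y :: "real ^ 'm"
    and \<epsilon> :: real
    and R K :: nat
    and B :: "nat \<Rightarrow> 'm set"
    and p :: "nat pmf"
    and M :: "'w measure"
    and \<rho> :: "nat \<Rightarrow> nat \<Rightarrow> 'w \<Rightarrow> nat"
    and \<mu> :: "nat \<Rightarrow> real"
    and z0 :: "complex ^ 'd"
    and z :: "nat \<Rightarrow> 'w \<Rightarrow> complex ^ 'd"
  assumes y_nonneg: "\<And>j. 0 \<le> y $ j"
    and eps_nonneg: "0 \<le> \<epsilon>"
    and R_bounds: "1 \<le> R" "R \<le> CARD('m)"
    and blocks_nonempty: "\<And>r. r \<in> {1..R} \<Longrightarrow> B r \<noteq> {}"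
    and blocks_disjoint: "disjoint_family_on B {1..R}"
    and blocks_cover: "(\<Union>r\<in>{1..R}. B r) = UNIV"
    and p_support: "set_pmf p \<subseteq> {1..R}"
    and p_bounds: "\<And>r. r \<in> {1..R} \<Longrightarrow> 0 < pmf p r \<and> pmf p r < 1"
    and K_pos: "1 \<le> K"
    and prob: "prob_space M"
    and indep: "prob_space.indep_vars M (\<lambda>_. count_space UNIV) (\<lambda>(t, k). \<rho> t k) (UNIV \<times> {1..K})"
    and distr: "\<And>t k. k \<in> {1..K} \<Longrightarrow> distr M (count_space UNIV) (\<rho> t k) = measure_pmf p"
    and z_0: "\<And>\<omega>. \<omega> \<in> space M \<Longrightarrow> z 0 \<omega> = z0"
    and z_Suc: "\<And>t \<omega>. \<omega> \<in> space M \<Longrightarrow>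
      z (Suc t) \<omega> = z t \<omega> - \<mu> t *\<^sub>R stoch_grad A y \<epsilon> B p K (\<lambda>k. \<rho> t k \<omega>) (z t \<omega>)"
    and mu_pos: "\<And>t. 0 < \<mu> t"
    and mu_sum: "filterlim (\<lambda>T. \<Sum>t<T. \<mu> t) at_top sequentially"
    and mu_sq: "summable (\<lambda>t. (\<mu> t)\<^sup>2)"
    and mu_le: "\<And>t. (1 - 1 / real K) * (spectral_norm A)\<^sup>2 * \<mu> t \<le> 1"
  shows
    "(\<forall>t. integrable M (\<lambda>\<omega>. amp_loss A y \<epsilon> (z t \<omega>)) \<and>
          integrable M (\<lambda>\<omega>. norm (amp_grad A y \<epsilon> (z t \<omega>))) \<and>
          integrable M (\<lambda>\<omega>. \<mu> t * (norm (amp_grad A y \<epsilon> (z t \<omega>)))\<^sup>2)) \<and>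
     convergent (\<lambda>t. \<integral>\<omega>. amp_loss A y \<epsilon> (z t \<omega>) \<partial>M) \<and>
     (\<exists>c\<ge>0. (\<lambda>t. \<integral>\<omega>. \<mu> t * (norm (amp_grad A y \<epsilon> (z t \<omega>)))\<^sup>2 \<partial>M) sums c\<^sup>2 \<and>
        (\<forall>T\<ge>1. (MIN t\<in>{..<T}. \<integral>\<omega>. norm (amp_grad A y \<epsilon> (z t \<omega>)) \<partial>M)
                  \<le> c * (\<Sum>t<T. \<mu> t) powr (- 1 / 2))) \<and>
     (\<lambda>T. MIN t\<in>{..<T}. \<integral>\<omega>. norm (amp_grad A y \<epsilon> (z t \<omega>)) \<partial>M) \<longlonglongrightarrow> 0 \<and>
     (decseq \<mu> \<and>
      filterlim (\<lambda>T. \<Sum>t=1..T. \<mu> t / (\<Sum>s<t. \<mu> s)) at_top sequentially \<longrightarrow>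
        (\<lambda>T. MIN t\<in>{..<T}. \<integral>\<omega>. norm (amp_grad A y \<epsilon> (z t \<omega>)) \<partial>M)
          \<in> o(\<lambda>T. (\<Sum>t<T. \<mu> t) powr (- 1 / 2)))"
proof -
  interpret prob_space M by (rule prob)
  \<comment> \<open>The sequence \<open>z\<close> is determined only on \<open>space M\<close>; \<open>Z\<close> extends it to all \<open>\<omega>\<close> as a function of the draws.\<close>
  define Z where "Z t \<omega> = saf_iterate A y \<epsilon> B p K \<mu> z0 (\<lambda>(s, k). \<rho> s k \<omega>) t" for t \<omega>
  have z_Z: "z t \<omega> = Z t \<omega>" if "\<omega> \<in> space M" for t \<omega>
    by (induction t) (simp_all add: Z_def z_0 z_Suc that)
  define G where "G t \<omega> = norm (amp_grad A y \<epsilon> (Z t \<omega>))" for t \<omega>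
  define L where "L t \<omega> = amp_loss A y \<epsilon> (Z t \<omega>)" for t \<omega>
  let ?V = "block_variance_bound A B p {1..R}"
  have int: "integrable M (\<lambda>\<omega>. h (Z t \<omega>))" for h :: "_ \<Rightarrow> real" and t
    unfolding Z_def by (rule integrable_saf_iterate[OF indep]) (rule finite_subset[OF p_support], simp)
  have step: "expectation (L (Suc t))
      \<le> (1 + ?V * (\<mu> t)\<^sup>2) * expectation (L t) - expectation (\<lambda>\<omega>. \<mu> t * (G t \<omega>)\<^sup>2)" for t
    unfolding L_def[abs_def] G_def
    by (rule expected_loss_recursion[OF y_nonneg eps_nonneg _ blocks_disjoint blocks_cover p_support
          _ K_pos indep distr _ mu_le Z_def])
      (use p_bounds mu_pos[of t] in auto)
  have L_nonneg: "0 \<le> expectation (L t)" for t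
    unfolding L_def by (intro Bochner_Integration.integral_nonneg amp_loss_nonneg)
  have G_nonneg: "0 \<le> expectation (\<lambda>\<omega>. \<mu> t * (G t \<omega>)\<^sup>2)" for t
    using mu_pos[of t] by (intro Bochner_Integration.integral_nonneg) simp
  have V_sum: "summable (\<lambda>t. ?V * (\<mu> t)\<^sup>2)"
    using mu_sq by (rule summable_mult)
  have V_nonneg: "0 \<le> ?V * (\<mu> t)\<^sup>2" for t
    by (simp add: block_variance_bound_nonneg)
  note rs = robbins_siegmund_deterministic[OF L_nonneg G_nonneg V_nonneg step V_sum]
  define b where "b t = expectation (G t)" for t
  have b_nonneg: "0 \<le> b t" for t
    unfolding b_def G_def by (intro Bochner_Integration.integral_nonneg) simp
  have b_le: "\<mu> t * (b t)\<^sup>2 \<le> expectation (\<lambda>\<omega>. \<mu> t * (G t \<omega>)\<^sup>2)" for t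
    using square_expectation_le[of "G t"] mu_pos[of t]
    by (simp add: b_def G_def[abs_def] int[of "\<lambda>x. norm (amp_grad A y \<epsilon> x)"]
        int[of "\<lambda>x. (norm (amp_grad A y \<epsilon> x))\<^sup>2"])
  have b_sum: "summable (\<lambda>t. \<mu> t * (b t)\<^sup>2)"
    by (rule summable_comparison_test'[OF rs(2), where N = 0])
      (use b_le mu_pos in \<open>simp add: less_imp_le\<close>)
  define c where "c = sqrt (\<Sum>t. expectation (\<lambda>\<omega>. \<mu> t * (G t \<omega>)\<^sup>2))"
  have c: "0 \<le> c" "c\<^sup>2 = (\<Sum>t. expectation (\<lambda>\<omega>. \<mu> t * (G t \<omega>)\<^sup>2))"
    unfolding c_def using suminf_nonneg[OF rs(2) G_nonneg] by simp_all
  have partial: "(\<Sum>t<T. \<mu> t * (b t)\<^sup>2) \<le> c\<^sup>2" for T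
  proof -
    have "(\<Sum>t<T. \<mu> t * (b t)\<^sup>2) \<le> (\<Sum>t<T. expectation (\<lambda>\<omega>. \<mu> t * (G t \<omega>)\<^sup>2))"
      by (intro sum_mono b_le)
    also have "\<dots> \<le> c\<^sup>2"
      unfolding c(2) by (intro sum_le_suminf rs(2) G_nonneg finite_lessThan)
    finally show ?thesis .
  qed
  have rate: "(MIN t\<in>{..<T}. b t) \<le> c * (\<Sum>t<T. \<mu> t) powr (- 1 / 2)" if "1 \<le> T" for T
    by (rule min_rate[OF b_nonneg mu_pos that c(1) partial])
  have lim: "(\<lambda>T. MIN t\<in>{..<T}. b t) \<longlonglongrightarrow> 0"
  proof (rule tendsto_sandwich)
    show "\<forall>\<^sub>F T in sequentially. 0 \<le> (MIN t\<in>{..<T}. b t)"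
      using eventually_ge_at_top[of 1]
      by eventually_elim (use b_nonneg in \<open>auto simp: Min_ge_iff lessThan_empty_iff\<close>)
    show "\<forall>\<^sub>F T in sequentially. (MIN t\<in>{..<T}. b t) \<le> c * (\<Sum>t<T. \<mu> t) powr (- 1 / 2)"
      using eventually_ge_at_top[of 1] by eventually_elim (rule rate)
    show "(\<lambda>T. c * (\<Sum>t<T. \<mu> t) powr (- 1 / 2)) \<longlonglongrightarrow> 0"
      by (intro tendsto_mult_right_zero tendsto_neg_powr mu_sum) simp
  qed simp
  have smallo: "(\<lambda>T. MIN t\<in>{..<T}. b t) \<in> o(\<lambda>T. (\<Sum>t<T. \<mu> t) powr (- 1 / 2))"
    by (rule min_rate_smallo[OF b_nonneg mu_pos mu_sum b_sum])
  have integrable: "integrable M (\<lambda>\<omega>. h (z t \<omega>))" for h :: "_ \<Rightarrow> real" and t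
    using int[of h t] by (simp add: z_Z cong: Bochner_Integration.integrable_cong)
  have expectations:
    "(\<integral>\<omega>. amp_loss A y \<epsilon> (z t \<omega>) \<partial>M) = expectation (L t)"
    "(\<integral>\<omega>. norm (amp_grad A y \<epsilon> (z t \<omega>)) \<partial>M) = b t"
    "(\<integral>\<omega>. \<mu> t * (norm (amp_grad A y \<epsilon> (z t \<omega>)))\<^sup>2 \<partial>M) = expectation (\<lambda>\<omega>. \<mu> t * (G t \<omega>)\<^sup>2)"
    for t
    unfolding b_def L_def[abs_def] G_def[abs_def]
    by (simp_all add: z_Z cong: Bochner_Integration.integral_cong)
  have sums: "(\<lambda>t. expectation (\<lambda>\<omega>. \<mu> t * (G t \<omega>)\<^sup>2)) sums c\<^sup>2"
    unfolding c(2) using rs(2) by (rule summable_sums)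
  show ?thesis
    unfolding expectations
    by (intro conjI allI exI[of _ c] impI integrable rs(1) c(1) sums rate lim smallo)
qed

end
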